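(* Let $k \geq 1$. Let $X$ be a finite connected simplicial complex on $n$ vertices which is a clique complex, and let $X'$ be a subcomplex of $X$ with the same $1$-skeleton as $X$, i.e. $G_{X'} = G_X$. If $$\lambda_2(G_X) > \frac{kn}{k+1} + \frac{k+2}{k+1}\, S_k(X,X'),$$ then $\widetilde{H}^k(X') = 0$.
   Context: Simplicial complexes are finite abstract simplicial complexes. For a complex $Y$, $Y(k)$ denotes its set of $k$-dimensional simplices, and $G_Y$ denotes its $1$-skeleton, i.e. the graph whose vertices are the $0$-simplices and whose edges are the $1$-simplices of $Y$; $Y$ is connected if $G_Y$ is connected. $X$ is a clique complex if for all $k\ge 0$ its $k$-simplices are exactly the $(k+1)$-cliques of $G_X$. For a graph $G$ with vertex set $V$, the (unnormalized) Laplacian $L(G)$ is the $V\times V$ matrix with $L(G)(x,x)=\deg(x)$, $L(G)(x,y)=-1$ if $x,y$ are adjacent and $0$ otherwise; its eigenvalues in ascending order are $0=\lambda_1(G)\le\lambda_2(G)\le\dots\le\lambda_{|V|}(G)$, and $\lambda_2(G)$ is the spectral gap. For a subcomplex $X'$ of $X$, $$S_k(X,X') := \max_{\sigma \in X'(k)} \left|\{\tau \in X(k+1)\setminus X'(k+1) \ : \ \sigma \subset \tau\}\right|$$ (a maximum over the empty set is taken to be $0$). $\widetilde{H}^k(Y)$ is the $k$-th reduced simplicial cohomology of $Y$ with real coefficients. *)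

theory Defs
  imports
    "HOL-Algebra.Elementary_Groups"
    "HOL-Combinatorics.Permutations"
    "Jordan_Normal_Form.Char_Poly"
    "Graph_Theory.Graph_Theory"
begin

section \<open>Simplicial complexes\<close>

text \<open>The empty simplex, of dimension \<open>-1\<close>, belongs to every complex.\<close>

definition simplicial_complex :: "'a set set \<Rightarrow> bool" where
  "simplicial_complex X \<longleftrightarrow>
     finite X \<and> (\<forall>\<sigma>\<in>X. finite \<sigma>) \<and> {} \<in> X \<and> (\<forall>\<sigma>\<in>X. \<forall>\<tau>. \<tau> \<subseteq> \<sigma> \<longrightarrow> \<tau> \<in> X)"

definition subcomplex :: "'a set set \<Rightarrow> 'a set set \<Rightarrow> bool" where
  "subcomplex X' X \<longleftrightarrow> simplicial_complex X' \<and> X' \<subseteq> X"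

definition simplices :: "'a set set \<Rightarrow> int \<Rightarrow> 'a set set" where
  "simplices X k = {\<sigma> \<in> X. int (card \<sigma>) = k + 1}"

text \<open>Graphs are symmetric loop-free digraphs: every edge contributes both of its orientations.\<close>

definition skeleton :: "'a set set \<Rightarrow> 'a pair_pre_digraph" where
  "skeleton X = \<lparr> pverts = {v. {v} \<in> simplices X 0}, parcs = {(u, v). {u, v} \<in> simplices X 1} \<rparr>"

definition connected_complex :: "'a set set \<Rightarrow> bool" where
  "connected_complex X \<longleftrightarrow> Digraph_Component.connected (with_proj (skeleton X))"

definition clique :: "'a pair_pre_digraph \<Rightarrow> 'a set \<Rightarrow> bool" where
  "clique G C \<longleftrightarrow>
     finite C \<and> C \<subseteq> pverts G \<and> (\<forall>u\<in>C. \<forall>v\<in>C. u \<noteq> v \<longrightarrow> (u, v) \<in> parcs G)"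

definition clique_complex :: "'a set set \<Rightarrow> bool" where
  "clique_complex X \<longleftrightarrow>
     (\<forall>k::nat. simplices X (int k) = {C. clique (skeleton X) C \<and> card C = k + 1})"

definition max_missing_cofaces :: "int \<Rightarrow> 'a set set \<Rightarrow> 'a set set \<Rightarrow> nat" where
  "max_missing_cofaces k X X' =
     (if simplices X' k = {} then 0
      else Max ((\<lambda>\<sigma>. card {\<tau> \<in> simplices X (k + 1) - simplices X' (k + 1). \<sigma> \<subset> \<tau>})
                  ` simplices X' k))"


section \<open>The graph Laplacian\<close>

text \<open>
  Rows and columns are indexed through an arbitrary enumeration of the (finitely many) vertices.
  Another enumeration conjugates the matrix by a permutation matrix, so the eigenvalues do not
  depend on the choice.
\<close>

definition vertex_list :: "'a pair_pre_digraph \<Rightarrow> 'a list" where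
  "vertex_list G = (SOME vs. distinct vs \<and> set vs = pverts G)"

definition laplacian :: "'a pair_pre_digraph \<Rightarrow> real mat" where
  "laplacian G =
     (let vs = vertex_list G in
        mat (length vs) (length vs) (\<lambda>(i, j).
          if i = j then real (out_degree (with_proj G) (vs ! i))
          else if (vs ! i, vs ! j) \<in> parcs G then - 1
          else 0))"

text \<open>
  \<open>laplacian_eigenvalue G i\<close> is the \<open>i\<close>-th smallest eigenvalue, counted from \<open>1\<close> and with
  multiplicity; it is meaningful for \<open>1 \<le> i \<le> card (pverts G)\<close> only. The Laplacian is
  symmetric, so its characteristic polynomial splits over the reals.
\<close>

definition laplacian_eigenvalue :: "'a pair_pre_digraph \<Rightarrow> nat \<Rightarrow> real" where
  "laplacian_eigenvalue G i =
     sorted_list_of_multiset (proots (char_poly (laplacian G))) ! (i - 1)"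

definition spectral_gap :: "'a pair_pre_digraph \<Rightarrow> real" where
  "spectral_gap G = laplacian_eigenvalue G 2"


section \<open>Reduced simplicial cohomology with real coefficients\<close>

definition ordered_simplices :: "'a set set \<Rightarrow> int \<Rightarrow> 'a list set" where
  "ordered_simplices X k = {vs. distinct vs \<and> set vs \<in> simplices X k}"

text \<open>
  Cochains are the alternating functions on ordered simplices, extended by zero to all lists.
\<close>

definition cochains :: "'a set set \<Rightarrow> int \<Rightarrow> ('a list \<Rightarrow> real) set" where
  "cochains X k =
     {\<phi>. (\<forall>vs. vs \<notin> ordered_simplices X k \<longrightarrow> \<phi> vs = 0) \<and>
         (\<forall>vs\<in>ordered_simplices X k. \<forall>p. p permutes {..<length vs} \<longrightarrow>
            \<phi> (permute_list p vs) = of_int (sign p) * \<phi> vs)}"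

definition cochain_group :: "'a set set \<Rightarrow> int \<Rightarrow> ('a list \<Rightarrow> real) monoid" where
  "cochain_group X k =
     \<lparr> carrier = cochains X k, monoid.mult = (\<lambda>\<phi> \<psi> vs. \<phi> vs + \<psi> vs), one = (\<lambda>vs. 0) \<rparr>"

definition coboundary :: "'a set set \<Rightarrow> int \<Rightarrow> ('a list \<Rightarrow> real) \<Rightarrow> 'a list \<Rightarrow> real" where
  "coboundary X k \<phi> vs =
     (if vs \<in> ordered_simplices X (k + 1)
      then \<Sum>i<length vs. (- 1) ^ i * \<phi> (take i vs @ drop (Suc i) vs)
      else 0)"

definition cocycles :: "'a set set \<Rightarrow> int \<Rightarrow> ('a list \<Rightarrow> real) set" where
  "cocycles X k = kernel (cochain_group X k) (cochain_group X (k + 1)) (coboundary X k)"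

definition coboundaries :: "'a set set \<Rightarrow> int \<Rightarrow> ('a list \<Rightarrow> real) set" where
  "coboundaries X k = coboundary X (k - 1) ` carrier (cochain_group X (k - 1))"

text \<open>
  The cohomology is recorded as the additive group of the quotient vector space, which is trivial
  precisely if the vector space is zero. It is reduced because the complex of cochains starts in
  degree \<open>-1\<close>, with the functions on the empty simplex.
\<close>

definition reduced_cohomology :: "'a set set \<Rightarrow> int \<Rightarrow> ('a list \<Rightarrow> real) set monoid" where
  "reduced_cohomology X k = (cochain_group X k)\<lparr>carrier := cocycles X k\<rparr> Mod coboundaries X k"

end

theory Submission
  imports Defs "HOL-Analysis.Function_Topology" "HOL-Analysis.Convex"
begin

text \<open>
  The proof shows that a class in \<open>H\<^sup>k(X')\<close> has a representative of norm zero. Orthogonal projection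
  replaces a cocycle of \<open>X'\<close> by a cohomologous \<open>h\<close> that is also coclosed, that is, orthogonal to all
  coboundaries (\<open>cocycle_coclosed_representative\<close>). Extended by zero to \<open>X\<close>, the cochain \<open>h\<close>
  stays coclosed, because a simplex outside \<open>X'\<close> has no coface in \<open>X'\<close>. Its coboundary
  \<open>\<delta>h\<close> in \<open>X\<close> need not vanish, but it lives on the simplices of \<open>X\<close> missing in \<open>X'\<close>.

  Two estimates bound the norm of \<open>h\<close>; norms are sums over ordered simplices, \<open>S\<close> is the maximal
  number of missing cofaces, and \<open>n\<close> is the number of vertices.
  \<^item> By Cauchy-Schwarz, \<open>\<parallel>\<delta>h\<parallel>\<^sup>2 \<le> (k + 2)\<^sup>2 S \<parallel>h\<parallel>\<^sup>2\<close> (\<open>cocycle_coboundary_estimate\<close>).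
  \<^item> A local-to-global argument in the style of Garland gives
    \<open>(k + 1) \<lambda>\<^sub>2 \<parallel>h\<parallel>\<^sup>2 \<le> k n \<parallel>h\<parallel>\<^sup>2 + \<parallel>\<delta>h\<parallel>\<^sup>2 / (k + 2)\<close> (\<open>spectral_gap_cochain_estimate\<close>).
    Fixing \<open>k\<close> of the \<open>k + 1\<close> arguments of \<open>h\<close> gives functions on the vertices with sum zero, whose
    energy is at least \<open>\<lambda>\<^sub>2\<close> times their squared norm (\<open>spectral_gap_le_rayleigh\<close>). In a clique
    complex the energies add up to \<open>\<parallel>\<delta>h\<parallel>\<^sup>2\<close>, scaled, and a remainder in the degrees of
    vertices and simplices, which is controlled by counting for each vertex its neighbours in
    a simplex (\<open>sum_degree_le\<close>).

  Together, \<open>(k + 1) \<lambda>\<^sub>2 \<parallel>h\<parallel>\<^sup>2 \<le> (k n + (k + 2) S) \<parallel>h\<parallel>\<^sup>2\<close>, so that \<open>h = 0\<close> whenever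
  \<open>\<lambda>\<^sub>2\<close> exceeds the bound. Passing from \<open>k\<close>-cochains to functions on vertices in a single step
  avoids an induction on \<open>k\<close> over the spectra of the higher Laplacians.
\<close>

section \<open>Alternating functions on lists\<close>

definition omit :: "nat \<Rightarrow> 'a list \<Rightarrow> 'a list" where
  "omit i xs = take i xs @ drop (Suc i) xs"

definition to_front :: "nat \<Rightarrow> 'a list \<Rightarrow> 'a list" where
  "to_front i xs = xs ! i # omit i xs"

text \<open>
  Exchanging neighbours generates all permutations, so this local condition is the alternation of
  cochains. It passes to the function obtained by fixing the first entry without any shift of
  positions, which makes it amenable to induction on lists.
\<close>

definition alternating :: "('a list \<Rightarrow> real) \<Rightarrow> bool" where
  "alternating \<phi> \<longleftrightarrow> (\<forall>xs a b ys. \<phi> (xs @ a # b # ys) = - \<phi> (xs @ b # a # ys))"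

text \<open>
  This is the alternating sum over the faces of a list, that is, the simplicial coboundary before
  any restriction to a complex. The recursion strips the first vertex, and therefore relates the
  coboundary of a function to that of its restriction to the link of this vertex.
\<close>

fun face_sum :: "('a list \<Rightarrow> real) \<Rightarrow> 'a list \<Rightarrow> real" where
  "face_sum \<phi> [] = 0"
| "face_sum \<phi> (x # xs) = \<phi> xs - face_sum (\<lambda>ys. \<phi> (x # ys)) xs"

lemma omit_0 [simp]: "omit 0 (x # xs) = xs"
  by (simp add: omit_def)

lemma omit_Suc [simp]: "omit (Suc i) (x # xs) = x # omit i xs"
  by (simp add: omit_def)

lemma tl_to_front [simp]: "tl (to_front i xs) = omit i xs"
  and hd_to_front [simp]: "hd (to_front i xs) = xs ! i"
  by (simp_all add: to_front_def)

lemma split_at_nth: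
  assumes "i < length xs"
  obtains ys zs where "xs = ys @ xs ! i # zs" "length ys = i" "omit i xs = ys @ zs"
proof (rule that)
  show "xs = take i xs @ xs ! i # drop (Suc i) xs" using assms by (rule id_take_nth_drop)
qed (use assms in \<open>simp_all add: omit_def\<close>)

lemma mset_to_front:
  assumes "i < length xs" shows "mset (to_front i xs) = mset xs"
proof -
  obtain ys zs where *: "xs = ys @ xs ! i # zs" "omit i xs = ys @ zs"
    using assms by (rule split_at_nth)
  have "mset xs = mset (ys @ xs ! i # zs)" using *(1) by simp
  then show ?thesis using *(2) by (simp add: to_front_def)
qed

lemma set_to_front [simp]: "i < length xs \<Longrightarrow> set (to_front i xs) = set xs"
  and distinct_to_front [simp]: "i < length xs \<Longrightarrow> distinct (to_front i xs) = distinct xs"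
  and length_to_front [simp]: "i < length xs \<Longrightarrow> length (to_front i xs) = length xs"
  using mset_to_front[of i xs] by (metis mset_eq_setD, metis mset_eq_imp_distinct_iff, metis size_mset)

lemma face_sum_eq: "face_sum \<phi> xs = (\<Sum>i<length xs. (- 1) ^ i * \<phi> (omit i xs))"
  by (induction \<phi> xs rule: face_sum.induct)
     (simp_all add: sum.lessThan_Suc_shift sum_negf del: sum.lessThan_Suc)

lemma face_sum_uminus: "face_sum (\<lambda>ys. - \<phi> ys) xs = - face_sum \<phi> xs"
  by (simp add: face_sum_eq sum_negf)

lemma face_sum_diff: "face_sum (\<lambda>ys. \<phi> ys - \<psi> ys) xs = face_sum \<phi> xs - face_sum \<psi> xs"
  by (simp add: face_sum_eq sum_subtractf right_diff_distrib)

lemma face_sum_add: "face_sum (\<lambda>ys. \<phi> ys + \<psi> ys) xs = face_sum \<phi> xs + face_sum \<psi> xs"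
  by (simp add: face_sum_eq sum.distrib distrib_left)

lemma face_sum_scale: "face_sum (\<lambda>ys. c * \<phi> ys) xs = c * face_sum \<phi> xs"
  by (simp add: face_sum_eq sum_distrib_left mult_ac)

text \<open>
  In the recursion, the term of the inner sum that omits the first vertex cancels against the term
  of the outer sum that omits it; what is left is the same double sum in the link of that vertex.
\<close>

lemma face_sum_face_sum: "face_sum (face_sum \<phi>) xs = 0"
proof (induction xs arbitrary: \<phi>)
  case (Cons x xs)
  have "face_sum (\<lambda>ys. face_sum \<phi> (x # ys)) xs
      = face_sum \<phi> xs - face_sum (face_sum (\<lambda>ys. \<phi> (x # ys))) xs"
    using face_sum_diff[of \<phi> "face_sum (\<lambda>ys. \<phi> (x # ys))" xs] by simp
  then show ?case using Cons by simp
qed simp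

lemma alternatingD: "alternating \<phi> \<Longrightarrow> \<phi> (xs @ a # b # ys) = - \<phi> (xs @ b # a # ys)"
  unfolding alternating_def by blast

lemma alternating_Cons:
  assumes "alternating \<phi>" shows "alternating (\<lambda>ys. \<phi> (x # ys))"
  unfolding alternating_def
proof (intro allI)
  fix xs a b ys
  show "\<phi> (x # xs @ a # b # ys) = - \<phi> (x # xs @ b # a # ys)"
    using alternatingD[OF assms, of "x # xs" a b ys] by simp
qed

lemma alternating_face_sum:
  assumes "alternating \<phi>" shows "alternating (face_sum \<phi>)"
proof -
  have "face_sum \<phi> (xs @ a # b # ys) = - face_sum \<phi> (xs @ b # a # ys)" for xs a b ys
    using assms
  proof (induction xs arbitrary: \<phi>)
    case Nil
    have "\<phi> (a # b # zs) = - \<phi> (b # a # zs)" for zs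
      using alternatingD[OF Nil, of "[]" a b zs] by simp
    then show ?case by (simp add: face_sum_uminus)
  next
    case (Cons x xs)
    have "\<phi> (xs @ a # b # ys) = - \<phi> (xs @ b # a # ys)"
      by (rule alternatingD[OF Cons.prems])
    then show ?case
      using Cons.IH[OF alternating_Cons[OF Cons.prems]] by simp
  qed
  then show ?thesis unfolding alternating_def by blast
qed

lemma alternating_move:
  assumes "alternating \<phi>"
  shows "\<phi> (xs @ a # ys @ zs) = (- 1) ^ length ys * \<phi> (xs @ ys @ a # zs)"
proof (induction ys arbitrary: xs)
  case (Cons y ys)
  have "\<phi> (xs @ a # (y # ys) @ zs) = - \<phi> ((xs @ [y]) @ a # ys @ zs)"
    using alternatingD[OF assms, of xs a y "ys @ zs"] by simp
  then show ?case using Cons[of "xs @ [y]"] by simp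
qed simp

lemma alternating_to_front:
  assumes "alternating \<phi>" "i < length xs"
  shows "\<phi> (to_front i xs) = (- 1) ^ i * \<phi> xs"
proof -
  obtain ys zs where *: "xs = ys @ xs ! i # zs" "length ys = i" "omit i xs = ys @ zs"
    using assms(2) by (rule split_at_nth)
  then have "\<phi> (to_front i xs) = \<phi> ([] @ xs ! i # ys @ zs)" by (simp add: to_front_def)
  also have "\<dots> = (- 1) ^ i * \<phi> xs" using alternating_move[OF assms(1), of "[]" "xs ! i" ys zs] * by simp
  finally show ?thesis .
qed

text \<open>
  Each of the two entries travels across the block between them, so the two signs from the block
  cancel and only the exchange of the entries themselves counts.
\<close>

lemma alternating_transpose:
  assumes "alternating \<phi>" "i < j" "j < length xs"
  shows "\<phi> (xs[i := xs ! j, j := xs ! i]) = - \<phi> xs"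
proof -
  have "i < length xs" using assms by simp
  then obtain A R where A: "xs = A @ xs ! i # R" "length A = i"
    by (rule split_at_nth)
  define n where "n = j - Suc i"
  have j: "j = Suc (i + n)" using assms by (simp add: n_def)
  have "length xs = Suc (i + length R)" by (subst A(1)) (simp add: A(2))
  then have n: "n < length R" using assms j by simp
  have nth: "xs ! j = R ! n" by (subst A(1)) (simp add: A(2) nth_append j)
  obtain B C where B: "R = B @ R ! n # C" "length B = n"
    using n by (rule split_at_nth)
  define a b where "a = xs ! i" and "b = xs ! j"
  have xs: "xs = A @ a # B @ b # C" using A(1) B(1) by (simp add: a_def b_def nth)
  have "xs[i := b, j := a] = A @ b # B @ a # C"
    unfolding j by (subst xs) (use A B in \<open>simp add: list_update_append\<close>)
  moreover have "\<phi> (A @ b # B @ a # C) = (- 1) ^ n * \<phi> (A @ B @ b # a # C)"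
    using alternating_move[OF assms(1), of A b B "a # C"] B by simp
  moreover have "\<phi> (A @ B @ b # a # C) = - \<phi> (A @ B @ a # b # C)"
    using alternatingD[OF assms(1), of "A @ B" b a C] by simp
  moreover have "\<phi> xs = (- 1) ^ n * \<phi> (A @ B @ a # b # C)"
    unfolding xs using alternating_move[OF assms(1), of A a B "b # C"] B by simp
  ultimately show ?thesis by (simp add: a_def b_def)
qed

lemma permute_list_transpose:
  assumes "i < length xs" "j < length xs"
  shows "permute_list (Transposition.transpose i j) xs = xs[i := xs ! j, j := xs ! i]"
  using assms by (intro nth_equalityI) (auto simp: permute_list_def Transposition.transpose_def nth_list_update)

lemma alternating_permute_list:
  assumes "alternating \<phi>" "p permutes {..<length xs}"
  shows "\<phi> (permute_list p xs) = of_int (sign p) * \<phi> xs"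
proof -
  have "\<forall>xs. length xs = n \<longrightarrow> \<phi> (permute_list p xs) = of_int (sign p) * \<phi> xs"
    if "p permutes {..<n}" for n
    using that finite_lessThan
  proof (induction rule: permutes_induct)
    case (swap a b p)
    show ?case
    proof (intro allI impI)
      fix xs :: "'a list" assume n: "length xs = n"
      let ?t = "Transposition.transpose a b"
      have t: "\<phi> (permute_list ?t xs) = - \<phi> xs"
        using alternating_transpose[OF assms(1), of a b xs] alternating_transpose[OF assms(1), of b a xs] swap n
        by (cases "a < b") (auto simp: permute_list_transpose list_update_swap)
      have "sign (?t \<circ> p) = - sign p"
        using swap by (subst sign_compose) (auto simp: sign_swap_id permutation_swap_id intro: permutes_imp_permutation)
      then show "\<phi> (permute_list (?t \<circ> p) xs) = of_int (sign (?t \<circ> p)) * \<phi> xs"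
        using swap n t by (simp add: permute_list_compose)
    qed
  qed (simp_all add: id_def)
  then show ?thesis using assms by blast
qed

text \<open>
  From here on, the cochains enter only through the exchange of neighbours and their support.
\<close>

lemma cochains_iff:
  "\<phi> \<in> cochains X m \<longleftrightarrow> alternating \<phi> \<and> (\<forall>vs. vs \<notin> ordered_simplices X m \<longrightarrow> \<phi> vs = 0)"
proof (intro iffI conjI)
  assume \<phi>: "\<phi> \<in> cochains X m"
  then show supp: "\<forall>vs. vs \<notin> ordered_simplices X m \<longrightarrow> \<phi> vs = 0" by (simp add: cochains_def)
  show "alternating \<phi>"
    unfolding alternating_def
  proof (intro allI)
    fix xs ys :: "'a list" and a b
    let ?u = "xs @ a # b # ys" and ?v = "xs @ b # a # ys"
    show "\<phi> ?u = - \<phi> ?v"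
    proof (cases "?v \<in> ordered_simplices X m")
      case True
      let ?t = "Transposition.transpose (length xs) (Suc (length xs))"
      have "?t permutes {..<length ?v}" by (rule permutes_swap_id) auto
      then have "\<phi> (permute_list ?t ?v) = of_int (sign ?t) * \<phi> ?v"
        using \<phi> True by (auto simp: cochains_def)
      moreover have "permute_list ?t ?v = ?u"
        by (subst permute_list_transpose) (simp_all add: list_update_append nth_append)
      ultimately show ?thesis by (simp add: sign_swap_id)
    next
      case False
      then have "?u \<notin> ordered_simplices X m" by (auto simp: ordered_simplices_def insert_commute)
      then show ?thesis using False supp by simp
    qed
  qed
next
  assume "alternating \<phi> \<and> (\<forall>vs. vs \<notin> ordered_simplices X m \<longrightarrow> \<phi> vs = 0)"
  then show "\<phi> \<in> cochains X m" by (simp add: cochains_def alternating_permute_list)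
qed

text \<open>
  All sums below run over every list of a given length over the vertices, not only over ordered
  simplices: cochains vanish elsewhere, and this index set splits off its first entry freely
  and is permuted by moving an entry to the front. Every simplex is counted
  once for each of its orderings.
\<close>

definition box :: "'a set \<Rightarrow> nat \<Rightarrow> 'a list set" where
  "box V m = {xs. set xs \<subseteq> V \<and> length xs = m}"

lemma finite_box: "finite V \<Longrightarrow> finite (box V m)"
  unfolding box_def by (rule finite_lists_length_eq)

lemma sum_box_Suc:
  "(\<Sum>xs\<in>box V (Suc m). g xs) = (\<Sum>v\<in>V. \<Sum>xs\<in>box V m. g (v # xs))"
proof -
  have "(\<Sum>xs\<in>box V (Suc m). g xs) = (\<Sum>(v, xs)\<in>V \<times> box V m. g (v # xs))"
    by (rule sum.reindex_bij_witness[of _ "\<lambda>(v, xs). v # xs" "\<lambda>xs. (hd xs, tl xs)"])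
       (auto simp: box_def length_Suc_conv)
  then show ?thesis by (simp add: sum.cartesian_product)
qed

lemma sum_box_to_front:
  assumes "finite V" "i < m"
  shows "(\<Sum>xs\<in>box V m. g (to_front i xs)) = (\<Sum>xs\<in>box V m. g xs)"
proof -
  define reinsert where "reinsert xs = take i (tl xs) @ hd xs # drop i (tl xs)" for xs :: "'a list"
  have "reinsert (to_front i xs) = xs" if "i < length xs" for xs
    using that by (simp add: reinsert_def omit_def to_front_def id_take_nth_drop[symmetric] min_def)
  then have "inj_on (to_front i) (box V m)"
    using assms by (auto simp: box_def intro!: inj_on_inverseI[of _ reinsert])
  moreover have "to_front i ` box V m \<subseteq> box V m"
    using assms by (force simp: box_def)
  ultimately have "to_front i ` box V m = box V m"
    using finite_box[OF assms(1)] by (simp add: endo_inj_surj)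
  with \<open>inj_on _ _\<close> have "bij_betw (to_front i) (box V m) (box V m)" by (simp add: bij_betw_def)
  then show ?thesis by (rule sum.reindex_bij_betw)
qed

lemma sum_box_fronts:
  fixes g :: "'a list \<Rightarrow> real"
  assumes "finite V"
  shows "(\<Sum>xs\<in>box V m. \<Sum>i<m. g (to_front i xs)) = real m * (\<Sum>xs\<in>box V m. g xs)"
  by (subst sum.swap) (simp add: sum_box_to_front[OF assms])

text \<open>
  All faces contribute equally to the pairing of an alternating function with a coboundary: after
  moving the omitted vertex to the front, the sign of the move cancels the sign of the face. With
  constant weight this says that the adjoint of the coboundary sums over the first vertex.
  A weight such as the indicator of a complex restricts the sum to simplices.
\<close>

lemma sum_box_face_sum:
  assumes "finite V" "alternating \<psi>" "\<And>i xs. i < length xs \<Longrightarrow> w (to_front i xs) = w xs"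
  shows "(\<Sum>xs\<in>box V m. w xs * (\<psi> xs * face_sum \<phi> xs))
       = real m * (\<Sum>xs\<in>box V m. w xs * (\<psi> xs * \<phi> (tl xs)))"
proof -
  have "w xs * (\<psi> xs * face_sum \<phi> xs)
      = (\<Sum>i<m. w (to_front i xs) * (\<psi> (to_front i xs) * \<phi> (tl (to_front i xs))))"
    if "xs \<in> box V m" for xs
    using that assms(2,3)
    by (auto simp: face_sum_eq box_def sum_distrib_left alternating_to_front mult_ac intro!: sum.cong)
  then have "(\<Sum>xs\<in>box V m. w xs * (\<psi> xs * face_sum \<phi> xs))
      = (\<Sum>xs\<in>box V m. \<Sum>i<m. w (to_front i xs) * (\<psi> (to_front i xs) * \<phi> (tl (to_front i xs))))"
    by (rule sum.cong[OF refl])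
  also have "\<dots> = real m * (\<Sum>xs\<in>box V m. w xs * (\<psi> xs * \<phi> (tl xs)))"
    by (rule sum_box_fronts[OF assms(1), where g = "\<lambda>xs. w xs * (\<psi> xs * \<phi> (tl xs))"])
  finally show ?thesis .
qed

section \<open>Coclosed representatives of cohomology classes\<close>

text \<open>
  The projection is built one coordinate at a time. Let \<open>W0\<close> be the part of \<open>W\<close> that vanishes at
  the new point \<open>a\<close>. On \<open>W0\<close> the inner products with and without \<open>a\<close> agree, so projections
  onto \<open>W0\<close> exist by induction; and \<open>W0\<close> has codimension at most one in \<open>W\<close>, with a
  complement spanned by a vector \<open>r\<close> orthogonal to \<open>W0\<close>, along which one more
  coefficient is adjusted.
\<close>

lemma orthogonal_projection:
  fixes W :: "('b \<Rightarrow> real) set"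
  assumes "finite F"
    and "(\<lambda>_. 0) \<in> W" "\<And>f g. f \<in> W \<Longrightarrow> g \<in> W \<Longrightarrow> (\<lambda>x. f x + g x) \<in> W"
      "\<And>c f. f \<in> W \<Longrightarrow> (\<lambda>x. c * f x) \<in> W"
  shows "\<exists>w\<in>W. \<forall>w'\<in>W. (\<Sum>x\<in>F. (f x - w x) * w' x) = 0"
  using assms
proof (induction F arbitrary: W f)
  case empty
  then show ?case by auto
next
  case (insert a F)
  note W = insert.prems
  define W0 where "W0 = {w \<in> W. w a = 0}"
  have proj: "\<exists>w\<in>W0. \<forall>w'\<in>W0. (\<Sum>x\<in>F. (f x - w x) * w' x) = 0" for f
    by (rule insert.IH) (use W in \<open>auto simp: W0_def\<close>)
  have diff: "(\<lambda>x. f x - c * g x) \<in> W" if "f \<in> W" "g \<in> W" for f g c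
    using W(2)[OF that(1) W(3)[OF that(2), of "- c"]] by simp
  show ?case
  proof (cases "W = W0")
    case True
    then have "w' a = 0" if "w' \<in> W" for w' using that by (auto simp: W0_def)
    moreover obtain w where w: "w \<in> W" "\<forall>w'\<in>W. (\<Sum>x\<in>F. (f x - w x) * w' x) = 0"
      using proj[of f] True by blast
    ultimately have "\<forall>w'\<in>W. (\<Sum>x\<in>insert a F. (f x - w x) * w' x) = 0"
      using insert.hyps by simp
    then show ?thesis using w(1) by blast
  next
    case False
    then obtain b where b: "b \<in> W" "b a \<noteq> 0" by (auto simp: W0_def)
    define ip where "ip f g = (\<Sum>x\<in>insert a F. f x * g x)" for f g :: "'b \<Rightarrow> real"
    have ip_diff: "ip (\<lambda>x. f x - c * g x) e = ip f e - c * ip g e" for f g e c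
      by (simp add: ip_def sum_subtractf sum_distrib_left left_diff_distrib mult.assoc right_diff_distrib)
    have proj': "\<exists>w\<in>W0. \<forall>w'\<in>W0. ip (\<lambda>x. f x - w x) w' = 0" for f
      using proj[of f] insert.hyps by (auto simp: W0_def ip_def)
    obtain b0 where b0: "b0 \<in> W0" "\<forall>w'\<in>W0. ip (\<lambda>x. b x - b0 x) w' = 0" using proj' by blast
    obtain f0 where f0: "f0 \<in> W0" "\<forall>w'\<in>W0. ip (\<lambda>x. f x - f0 x) w' = 0" using proj' by blast
    define r where "r = (\<lambda>x. b x - b0 x)"
    define g where "g = (\<lambda>x. f x - f0 x)"
    have r: "r \<in> W" "r a \<noteq> 0" using diff[of b b0 1] b b0(1) by (auto simp: r_def W0_def)
    have r_pos: "ip r r > 0"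
      unfolding ip_def using insert.hyps(1) r(2) by (intro sum_pos2[of _ a]) (auto simp: zero_less_mult_iff)
    define c where "c = ip g r / ip r r"
    have "(\<lambda>x. f0 x + c * r x) \<in> W" using W(2) W(3) f0(1) r(1) by (simp add: W0_def)
    moreover have "(\<Sum>x\<in>insert a F. (f x - (f0 x + c * r x)) * w x) = 0" if w: "w \<in> W" for w
    proof -
      define d where "d = w a / r a"
      define w0 where "w0 = (\<lambda>x. w x - d * r x)"
      have "w0 \<in> W0" using diff[OF w r(1), of d] r(2) by (simp add: W0_def w0_def d_def)
      then have orth: "ip g w0 = 0" "ip r w0 = 0" using f0(2) b0(2) by (auto simp: g_def r_def)
      have "(\<Sum>x\<in>insert a F. (f x - (f0 x + c * r x)) * w x) = ip (\<lambda>x. g x - c * r x) w"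
        by (simp add: ip_def g_def algebra_simps)
      also have "\<dots> = ip g w - c * ip r w" by (rule ip_diff)
      also have "ip g w = ip g w0 + d * ip g r"
        using ip_diff[of w d r g] by (simp add: w0_def ip_def mult.commute)
      also have "ip r w = ip r w0 + d * ip r r"
        using ip_diff[of w d r r] by (simp add: w0_def ip_def mult.commute)
      finally show ?thesis using orth r_pos by (simp add: c_def)
    qed
    ultimately show ?thesis by (intro bexI[of _ "\<lambda>x. f0 x + c * r x"] ballI)
  qed
qed

lemma ordered_simplices_iff:
  "vs \<in> ordered_simplices X m \<longleftrightarrow> distinct vs \<and> set vs \<in> X \<and> int (length vs) = m + 1"
  by (auto simp: ordered_simplices_def simplices_def distinct_card)

lemma simplicial_complexD:
  assumes "simplicial_complex X"
  shows "\<And>\<sigma> \<tau>. \<sigma> \<in> X \<Longrightarrow> \<tau> \<subseteq> \<sigma> \<Longrightarrow> \<tau> \<in> X" "finite (\<Union>X)"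
  using assms by (auto simp: simplicial_complex_def)

lemma omit_ordered_simplices:
  assumes "simplicial_complex X" "vs \<in> ordered_simplices X (m + 1)" "i < length vs"
  shows "omit i vs \<in> ordered_simplices X m"
proof -
  have "set (omit i vs) \<subseteq> set vs" "distinct (omit i vs)" "Suc (length (omit i vs)) = length vs"
    using assms(2,3) set_to_front[of i vs] distinct_to_front[of i vs] length_to_front[of i vs]
    by (auto simp: to_front_def ordered_simplices_iff)
  then show ?thesis
    using assms simplicial_complexD(1)[OF assms(1)] by (auto simp: ordered_simplices_iff)
qed

lemma coboundary_eq:
  "coboundary X m \<phi> vs = (if vs \<in> ordered_simplices X (m + 1) then face_sum \<phi> vs else 0)"
  by (simp add: coboundary_def face_sum_eq omit_def)

lemma cochains_closed:
  shows "(\<lambda>_. 0) \<in> cochains X m"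
    and "\<phi> \<in> cochains X m \<Longrightarrow> \<psi> \<in> cochains X m \<Longrightarrow> (\<lambda>vs. \<phi> vs + \<psi> vs) \<in> cochains X m"
    and "\<phi> \<in> cochains X m \<Longrightarrow> (\<lambda>vs. c * \<phi> vs) \<in> cochains X m"
  by (auto simp: cochains_def algebra_simps)

lemma coboundaries_closed:
  shows "(\<lambda>_. 0) \<in> coboundaries X m"
    and "\<phi> \<in> coboundaries X m \<Longrightarrow> \<psi> \<in> coboundaries X m \<Longrightarrow> (\<lambda>vs. \<phi> vs + \<psi> vs) \<in> coboundaries X m"
    and "\<phi> \<in> coboundaries X m \<Longrightarrow> (\<lambda>vs. c * \<phi> vs) \<in> coboundaries X m"
proof -
  let ?\<delta> = "coboundary X (m - 1)" and ?C = "cochains X (m - 1)"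
  have eq: "coboundaries X m = ?\<delta> ` ?C" by (simp add: coboundaries_def cochain_group_def)
  have "?\<delta> (\<lambda>_. 0) = (\<lambda>_. 0)" by (simp add: coboundary_eq fun_eq_iff face_sum_eq)
  then show "(\<lambda>_. 0) \<in> coboundaries X m" unfolding eq using cochains_closed(1) by (metis imageI)
  have add: "?\<delta> (\<lambda>vs. \<phi> vs + \<psi> vs) = (\<lambda>vs. ?\<delta> \<phi> vs + ?\<delta> \<psi> vs)" for \<phi> \<psi>
    by (auto simp: coboundary_eq face_sum_add)
  show "(\<lambda>vs. \<phi> vs + \<psi> vs) \<in> coboundaries X m" if "\<phi> \<in> coboundaries X m" "\<psi> \<in> coboundaries X m"
    using that unfolding eq by (auto simp: add[symmetric] intro!: imageI cochains_closed)
  have scale: "?\<delta> (\<lambda>vs. c * \<phi> vs) = (\<lambda>vs. c * ?\<delta> \<phi> vs)" for \<phi> c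
    by (auto simp: coboundary_eq face_sum_scale)
  show "(\<lambda>vs. c * \<phi> vs) \<in> coboundaries X m" if "\<phi> \<in> coboundaries X m"
    using that unfolding eq by (auto simp: scale[symmetric] intro!: imageI cochains_closed)
qed

text \<open>
  The coset of a coboundary is the set of all coboundaries, so under this inclusion the quotient
  has a single element.
\<close>

lemma trivial_reduced_cohomologyI:
  assumes "cocycles X m \<subseteq> coboundaries X m"
  shows "trivial_group (reduced_cohomology X m)"
proof -
  let ?B = "coboundaries X m" and ?Q = "reduced_cohomology X m"
  let ?Z = "(cochain_group X m)\<lparr>carrier := cocycles X m\<rparr>"
  have coset: "?B #>\<^bsub>?Z\<^esub> a = ?B" if a: "a \<in> ?B" for a
  proof
    show "?B #>\<^bsub>?Z\<^esub> a \<subseteq> ?B"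
      using coboundaries_closed(2) a by (auto simp: r_coset_def cochain_group_def)
    show "?B \<subseteq> ?B #>\<^bsub>?Z\<^esub> a"
    proof
      fix b assume "b \<in> ?B"
      then have "(\<lambda>vs. b vs + - 1 * a vs) \<in> ?B" by (intro coboundaries_closed a)
      moreover have "b = (\<lambda>vs. (b vs + - 1 * a vs) + a vs)" by simp
      ultimately show "b \<in> ?B #>\<^bsub>?Z\<^esub> a"
        by (auto simp: r_coset_def cochain_group_def intro!: bexI[of _ "\<lambda>vs. b vs + - 1 * a vs"])
    qed
  qed
  have "(\<lambda>_. 0) \<in> cocycles X m"
    by (simp add: cochains_closed(1) cocycles_def kernel_def cochain_group_def coboundary_eq face_sum_eq fun_eq_iff)
  then have carrier: "carrier ?Q = {?B}"
    using coset assms by (auto simp: reduced_cohomology_def carrier_FactGroup)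
  have "set_mult ?Z ?B ?B = (\<Union>a\<in>?B. ?B #>\<^bsub>?Z\<^esub> a)"
    by (auto simp: set_mult_def r_coset_def)
  also have "\<dots> = ?B" using coset coboundaries_closed(1) by auto
  finally have mult: "?B \<otimes>\<^bsub>?Q\<^esub> ?B = ?B" by (simp add: reduced_cohomology_def)
  have one: "\<one>\<^bsub>?Q\<^esub> = ?B" by (simp add: reduced_cohomology_def)
  have "group ?Q" by (rule groupI) (auto simp: carrier mult one)
  then show ?thesis by (simp add: trivial_group_def carrier one)
qed

text \<open>
  The Hodge representative of a cohomology class is what remains of a cocycle after its orthogonal
  projection onto the coboundaries. Being orthogonal to all coboundaries, it is annihilated
  by the adjoint of the coboundary, and this adjoint sums over the first vertex.
\<close>

lemma cocycle_coclosed_representative: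
  assumes X: "simplicial_complex X" and \<phi>: "\<phi> \<in> cocycles X (int k)"
  obtains h where "h \<in> cochains X (int k)"
    "(\<lambda>vs. \<phi> vs - h vs) \<in> coboundaries X (int k)"
    "\<And>vs. vs \<in> ordered_simplices X (int k + 1) \<Longrightarrow> face_sum h vs = 0"
    "\<And>vs. (\<Sum>v\<in>\<Union>X. h (v # vs)) = 0"
proof -
  let ?V = "\<Union>X" and ?C = "cochains X (int k - 1)" and ?\<delta> = "coboundary X (int k - 1)"
  note fin = simplicial_complexD(2)[OF X]
  obtain w where w: "w \<in> coboundaries X (int k)"
    and orth: "\<forall>w'\<in>coboundaries X (int k). (\<Sum>vs\<in>box ?V (Suc k). (\<phi> vs - w vs) * w' vs) = 0"
    using orthogonal_projection[OF finite_box[OF fin] coboundaries_closed] by blast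
  obtain \<psi> where \<psi>: "\<psi> \<in> ?C" "w = ?\<delta> \<psi>"
    using w by (auto simp: coboundaries_def cochain_group_def)
  define h where "h vs = \<phi> vs - w vs" for vs
  have \<phi>': "\<phi> \<in> cochains X (int k)" "\<And>vs. vs \<in> ordered_simplices X (int k + 1) \<Longrightarrow> face_sum \<phi> vs = 0"
    using \<phi> by (auto simp: cocycles_def kernel_def cochain_group_def coboundary_eq fun_eq_iff split: if_splits)
  have alt_w: "alternating w"
    unfolding alternating_def
  proof (intro allI)
    fix xs a b ys
    have "xs @ a # b # ys \<in> ordered_simplices X (int k) \<longleftrightarrow> xs @ b # a # ys \<in> ordered_simplices X (int k)"
      by (auto simp: ordered_simplices_iff insert_commute)
    moreover have "face_sum \<psi> (xs @ a # b # ys) = - face_sum \<psi> (xs @ b # a # ys)"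
      using \<psi>(1) by (intro alternatingD alternating_face_sum) (simp add: cochains_iff)
    ultimately show "w (xs @ a # b # ys) = - w (xs @ b # a # ys)"
      by (simp add: \<psi>(2) coboundary_eq)
  qed
  then have "w \<in> cochains X (int k)" by (simp add: cochains_iff \<psi>(2) coboundary_eq)
  then have h: "h \<in> cochains X (int k)"
    using cochains_closed(2)[OF \<phi>'(1) cochains_closed(3), of w "- 1"] by (simp add: h_def[abs_def])
  then have alt_h: "alternating h" and supp_h: "\<And>vs. vs \<notin> ordered_simplices X (int k) \<Longrightarrow> h vs = 0"
    by (auto simp: cochains_iff)
  have cocycle: "face_sum h vs = 0" if vs: "vs \<in> ordered_simplices X (int k + 1)" for vs
  proof -
    have "face_sum w vs = face_sum (face_sum \<psi>) vs"
      unfolding face_sum_eq[of w] face_sum_eq[of "face_sum \<psi>"]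
      using omit_ordered_simplices[OF X vs] by (simp add: \<psi>(2) coboundary_eq)
    then show ?thesis
      using \<phi>'(2)[OF vs] face_sum_diff[of \<phi> w vs] by (simp add: h_def[abs_def] face_sum_face_sum)
  qed
  \<comment> \<open>Testing orthogonality against the coboundary of the adjoint \<open>\<chi>\<close> of \<open>h\<close> itself
  yields the squared norm of \<open>\<chi>\<close>.\<close>
  define \<chi> where "\<chi> vs = (\<Sum>v\<in>?V. h (v # vs))" for vs
  have supp: "\<chi> vs = 0" if "vs \<notin> ordered_simplices X (int k - 1)" for vs
    unfolding \<chi>_def
  proof (rule sum.neutral, rule ballI, rule supp_h, rule notI)
    fix v assume "v # vs \<in> ordered_simplices X (int k)"
    then have "vs \<in> ordered_simplices X (int k - 1)"
      using omit_ordered_simplices[OF X, of "v # vs" "int k - 1" 0] by simp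
    then show False using that by simp
  qed
  have "alternating \<chi>"
    unfolding alternating_def \<chi>_def sum_negf[symmetric]
    by (intro allI sum.cong refl alternatingD[OF alternating_Cons[OF alt_h]])
  then have "\<chi> \<in> ?C" using supp by (simp add: cochains_iff)
  then have "?\<delta> \<chi> \<in> coboundaries X (int k)" by (simp add: coboundaries_def cochain_group_def)
  then have "0 = (\<Sum>vs\<in>box ?V (Suc k). h vs * ?\<delta> \<chi> vs)" using orth by (simp add: h_def)
  also have "\<dots> = (\<Sum>vs\<in>box ?V (Suc k). 1 * (h vs * face_sum \<chi> vs))"
    by (intro sum.cong refl) (auto simp: coboundary_eq supp_h)
  also have "\<dots> = real (Suc k) * (\<Sum>vs\<in>box ?V (Suc k). 1 * (h vs * \<chi> (tl vs)))"
    by (rule sum_box_face_sum[OF fin alt_h]) simp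
  also have "(\<Sum>vs\<in>box ?V (Suc k). 1 * (h vs * \<chi> (tl vs))) = (\<Sum>vs\<in>box ?V k. \<Sum>v\<in>?V. h (v # vs) * \<chi> vs)"
    by (simp add: sum_box_Suc) (rule sum.swap)
  also have "\<dots> = (\<Sum>vs\<in>box ?V k. (\<chi> vs)\<^sup>2)"
    by (simp add: \<chi>_def power2_eq_square sum_distrib_right)
  finally have "\<chi> vs = 0" if "vs \<in> box ?V k" for vs
    using that finite_box[OF fin] by (simp add: sum_nonneg_eq_0_iff)
  moreover have "vs \<in> box ?V k" if "vs \<in> ordered_simplices X (int k - 1)" for vs
    using that by (auto simp: ordered_simplices_iff box_def)
  ultimately have "\<chi> vs = 0" for vs using supp by blast
  then show thesis using that[OF h _ cocycle] w by (simp add: h_def \<chi>_def)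
qed

section \<open>The spectral gap of a graph\<close>

definition adj :: "'a pair_pre_digraph \<Rightarrow> 'a \<Rightarrow> 'a \<Rightarrow> real" where
  "adj G u v = of_bool ((u, v) \<in> parcs G)"

text \<open>
  The Laplacian as an operator on functions on the vertices, free of any enumeration. In this form
  it visibly annihilates constants.
\<close>

definition lap :: "'a pair_pre_digraph \<Rightarrow> ('a \<Rightarrow> real) \<Rightarrow> 'a \<Rightarrow> real" where
  "lap G f v = (\<Sum>u\<in>pverts G. adj G v u * (f v - f u))"

definition energy :: "'a pair_pre_digraph \<Rightarrow> ('a \<Rightarrow> real) \<Rightarrow> ('a \<Rightarrow> real) \<Rightarrow> real" where
  "energy G f g = (\<Sum>v\<in>pverts G. lap G f v * g v)"

lemma vertex_list:
  assumes "finite (pverts G)"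
  shows "distinct (vertex_list G)" "set (vertex_list G) = pverts G"
  using someI_ex[OF finite_distinct_list[OF assms]]
  by (auto simp: vertex_list_def conj_commute)

text \<open>
  This is the first-order condition at a minimum, for a quadratic function of one real variable.
\<close>

lemma nonneg_parabola_imp_zero:
  fixes a c :: real
  assumes "\<And>t. 0 \<le> 2 * t * a + t\<^sup>2 * c"
  shows "a = 0"
proof (rule ccontr)
  assume a: "a \<noteq> 0"
  define d where "d = \<bar>c\<bar> + 1"
  have d: "d > 0" "c \<le> d" by (auto simp: d_def)
  have "0 \<le> 2 * (- a / d) * a + (- a / d)\<^sup>2 * c" by (rule assms)
  also have "\<dots> \<le> 2 * (- a / d) * a + (- a / d)\<^sup>2 * d"
    using d by (intro add_left_mono mult_left_mono) auto
  also have "\<dots> = - (a\<^sup>2 / d)" using d by (simp add: power2_eq_square field_simps)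
  also have "\<dots> < 0" using a d by simp
  finally show False by simp
qed

context pair_graph
begin

lemma adj_commute: "adj G u v = adj G v u"
  using pair_sym_arcs by (auto simp: adj_def symmetric_def dest: symD)

text \<open>
  Summation by parts: this form makes the energy symmetric and nonnegative, and the choice of a
  constant as second argument shows that Laplacians sum to zero.
\<close>

lemma energy_eq: "energy G f g = (\<Sum>v\<in>pverts G. \<Sum>u\<in>pverts G. adj G v u * (f v - f u) * (g v - g u)) / 2"
proof -
  have "energy G f g = (\<Sum>v\<in>pverts G. \<Sum>u\<in>pverts G. adj G v u * (f v - f u) * g v)"
    by (simp add: energy_def lap_def sum_distrib_right)
  moreover from this have "energy G f g = (\<Sum>v\<in>pverts G. \<Sum>u\<in>pverts G. adj G v u * (f u - f v) * g u)"
    by (subst (asm) sum.swap) (simp add: adj_commute)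
  ultimately have "2 * energy G f g = (\<Sum>v\<in>pverts G. \<Sum>u\<in>pverts G.
      adj G v u * (f v - f u) * g v + adj G v u * (f u - f v) * g u)"
    by (simp add: sum.distrib)
  also have "\<dots> = (\<Sum>v\<in>pverts G. \<Sum>u\<in>pverts G. adj G v u * (f v - f u) * (g v - g u))"
    by (intro sum.cong refl) (simp add: algebra_simps)
  finally show ?thesis by simp
qed

lemma sum_lap: "(\<Sum>v\<in>pverts G. lap G f v) = 0"
  using energy_eq[of f "\<lambda>_. 1"] by (simp add: energy_def)

lemma laplacian_mult:
  assumes "i < length (vertex_list G)"
  shows "(\<Sum>j<length (vertex_list G). laplacian G $$ (i, j) * f (vertex_list G ! j)) = lap G f (vertex_list G ! i)"
proof -
  let ?vs = "vertex_list G" and ?V = "pverts G"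
  let ?v = "?vs ! i"
  note vs = vertex_list[OF pair_finite_verts]
  have bij: "bij_betw ((!) ?vs) {..<length ?vs} ?V"
    using bij_betw_nth[OF vs(1) refl refl] vs(2) by simp
  have v: "?v \<in> ?V" using assms vs(2) nth_mem by blast
  define d where "d = (\<Sum>u\<in>?V. adj G ?v u)"
  have deg: "real (out_degree (with_proj G) ?v) = d"
  proof -
    have "out_arcs (with_proj G) ?v = Pair ?v ` {u \<in> ?V. (?v, u) \<in> parcs G}"
      by (auto simp: out_arcs_def image_iff dest: in_arcsD2)
    then have "out_degree (with_proj G) ?v = card {u \<in> ?V. (?v, u) \<in> parcs G}"
      by (simp add: out_degree_def card_image inj_on_def)
    then show ?thesis using pair_finite_verts by (simp add: d_def adj_def of_bool_def sum.If_cases Int_def)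
  qed
  have loop: "adj G ?v ?v = 0" using no_loops' by (auto simp: adj_def)
  have "(\<Sum>j<length ?vs. laplacian G $$ (i, j) * f (?vs ! j))
      = (\<Sum>j<length ?vs. ((if ?vs ! j = ?v then d else 0) - adj G ?v (?vs ! j)) * f (?vs ! j))"
    using assms vs(1) loop by (intro sum.cong refl)
      (auto simp: laplacian_def Let_def deg nth_eq_iff_index_eq adj_def)
  also have "\<dots> = (\<Sum>w\<in>?V. ((if w = ?v then d else 0) - adj G ?v w) * f w)"
    by (rule sum.reindex_bij_betw[OF bij])
  also have "\<dots> = (\<Sum>w\<in>?V. if w = ?v then d * f ?v else 0) - (\<Sum>w\<in>?V. adj G ?v w * f w)"
    unfolding sum_subtractf[symmetric] by (intro sum.cong refl) (auto simp: algebra_simps)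
  also have "\<dots> = lap G f ?v"
    using v pair_finite_verts by (simp add: d_def lap_def sum_subtractf right_diff_distrib sum_distrib_right)
  finally show ?thesis .
qed

lemma eigenfunction_imp_root:
  assumes eig: "\<And>v. v \<in> pverts G \<Longrightarrow> lap G f v = c * f v" and nz: "w \<in> pverts G" "f w \<noteq> 0"
  shows "c \<in># proots (char_poly (laplacian G))"
proof -
  let ?vs = "vertex_list G"
  let ?n = "length ?vs"
  note vs = vertex_list[OF pair_finite_verts]
  define x where "x = vec ?n (\<lambda>i. f (?vs ! i))"
  have L: "laplacian G \<in> carrier_mat ?n ?n" by (simp add: laplacian_def Let_def)
  obtain i where i: "i < ?n" "?vs ! i = w" using nz vs(2) by (metis in_set_conv_nth)
  have "x \<noteq> 0\<^sub>v ?n"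
  proof
    assume "x = 0\<^sub>v ?n"
    then have "x $ i = 0" using i by simp
    then show False using i nz by (simp add: x_def)
  qed
  moreover have "laplacian G *\<^sub>v x = c \<cdot>\<^sub>v x"
  proof (rule eq_vecI)
    fix j assume "j < dim_vec (c \<cdot>\<^sub>v x)"
    then have j: "j < ?n" by (simp add: x_def)
    then have "(laplacian G *\<^sub>v x) $ j = (\<Sum>k<?n. laplacian G $$ (j, k) * f (?vs ! k))"
      using L by (simp add: x_def scalar_prod_def lessThan_atLeast0)
    also have "\<dots> = lap G f (?vs ! j)" by (rule laplacian_mult[OF j])
    also have "\<dots> = c * f (?vs ! j)" using j vs(2) nth_mem eig by blast
    finally show "(laplacian G *\<^sub>v x) $ j = (c \<cdot>\<^sub>v x) $ j" using j by (simp add: x_def)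
  qed (use L in \<open>simp add: x_def\<close>)
  ultimately have "eigenvalue (laplacian G) c"
    using L unfolding eigenvalue_def eigenvector_def by (intro exI[of _ x]) (simp add: x_def)
  moreover have "char_poly (laplacian G) \<noteq> 0" using degree_monic_char_poly[OF L] by auto
  ultimately show ?thesis using eigenvalue_root_char_poly[OF L] by simp
qed

text \<open>
  On functions with sum zero, the quotient of energy and squared norm attains its minimum by
  compactness of the unit sphere, and the minimiser is an eigenfunction: the residue \<open>r\<close> of the
  eigenvalue equation has sum zero itself, so it is an admissible direction of variation,
  and stationarity in this direction says that \<open>r\<close> has norm zero.
\<close>

lemma rayleigh_minimiser:
  fixes g :: "'a \<Rightarrow> real"
  assumes "sum g (pverts G) = 0" "v \<in> pverts G" "g v \<noteq> 0"
  obtains f \<mu> where "sum f (pverts G) = 0" "(\<Sum>v\<in>pverts G. (f v)\<^sup>2) = 1"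
    "\<And>v. v \<in> pverts G \<Longrightarrow> lap G f v = \<mu> * f v"
    "\<And>h. sum h (pverts G) = 0 \<Longrightarrow> \<mu> * (\<Sum>v\<in>pverts G. (h v)\<^sup>2) \<le> energy G h h"
proof -
  let ?V = "pverts G"
  have fin: "finite ?V" using pair_finite_verts by simp
  define nrm where "nrm h = (\<Sum>v\<in>?V. (h v)\<^sup>2)" for h :: "'a \<Rightarrow> real"
  \<comment> \<open>Functions vanishing off the vertices form a closed set in the product topology, and
  boundedness on the vertices then gives compactness by Tychonoff.\<close>
  define K where "K = (\<Pi>\<^sub>E v\<in>UNIV. if v \<in> ?V then {-1..1::real} else {0})"
  define S where "S = K \<inter> ({h. sum h ?V = (0::real)} \<inter> {h. nrm h = 1})"
  have coord: "continuous_on A (\<lambda>h::'a \<Rightarrow> real. h v)" for A v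
    by (rule continuous_on_subset[OF continuous_on_product_coordinates subset_UNIV])
  have "compact K"
    using compactin_PiE[of "\<lambda>_. euclidean" UNIV "\<lambda>v. if v \<in> ?V then {-1..1::real} else {0}"]
    by (simp add: K_def euclidean_product_topology)
  moreover have "closed {h. sum h ?V = (0::real)}"
    by (rule closed_Collect_eq) (intro continuous_on_sum coord continuous_on_const)+
  moreover have "closed {h. nrm h = 1}"
    unfolding nrm_def by (rule closed_Collect_eq) (intro continuous_intros coord)+
  ultimately have "compact S" unfolding S_def by (intro compact_Int_closed closed_Int)
  have nrm_pos: "nrm h > 0" if "v \<in> ?V" "h v \<noteq> 0" for h v
    unfolding nrm_def using that fin by (intro sum_pos2[of _ v]) auto
  have normalise: "\<exists>h'\<in>S. energy G h h = nrm h * energy G h' h'" if h: "sum h ?V = 0" "nrm h > 0" for h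
  proof
    define h' where "h' v = (if v \<in> ?V then h v / sqrt (nrm h) else 0)" for v
    have "(h v)\<^sup>2 \<le> nrm h" if "v \<in> ?V" for v
      unfolding nrm_def using that fin by (intro member_le_sum) auto
    then have "\<bar>h' v\<bar> \<le> 1" for v
      using h(2) by (auto simp: h'_def abs_le_square_iff[symmetric] real_le_rsqrt intro!: real_le_rsqrt)
    then have "h' v \<in> {-1..1}" for v by (simp add: abs_le_iff minus_le_iff)
    moreover have "h' v = 0" if "v \<notin> ?V" for v using that by (simp add: h'_def)
    ultimately have "h' \<in> K" unfolding K_def by (simp add: PiE_UNIV_domain)
    moreover have "sum h' ?V = 0" using h(1) by (simp add: h'_def sum_divide_distrib[symmetric])
    moreover have "nrm h' = 1"
      using h(2) by (simp add: h'_def nrm_def power_divide sum_divide_distrib[symmetric])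
    ultimately show "h' \<in> S" by (simp add: S_def)
    have "energy G h' h' = energy G h h / nrm h"
      using h(2) unfolding energy_eq
      by (simp add: h'_def sum_divide_distrib diff_divide_distrib[symmetric] mult.commute[of 2])
    then show "energy G h h = nrm h * energy G h' h'" using h(2) by simp
  qed
  have "S \<noteq> {}" using normalise[OF assms(1) nrm_pos[of v g, OF assms(2,3)]] by blast
  moreover have "continuous_on S (\<lambda>h. energy G h h)"
    unfolding energy_def lap_def
    by (intro continuous_intros coord)
  ultimately obtain f where f: "f \<in> S" and f_min: "\<And>h. h \<in> S \<Longrightarrow> energy G f f \<le> energy G h h"
    using continuous_attains_inf[OF \<open>compact S\<close>] by blast
  define \<mu> where "\<mu> = energy G f f"
  have f0: "sum f ?V = 0" and f1: "nrm f = 1" using f by (auto simp: S_def)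
  have min: "\<mu> * nrm h \<le> energy G h h" if "sum h ?V = 0" for h
  proof (cases "nrm h > 0")
    case True
    then obtain h' where "h' \<in> S" "energy G h h = nrm h * energy G h' h'" 
      using normalise[of h] \<open>sum h ?V = 0\<close> by blast
    then show ?thesis using f_min[of h'] True by (simp add: \<mu>_def mult.commute)
  next
    case False
    then have "h v = 0" if "v \<in> ?V" for v using nrm_pos that by blast
    then show ?thesis by (simp add: nrm_def energy_def)
  qed
  define r where "r v = lap G f v - \<mu> * f v" for v
  have r0: "sum r ?V = 0" using f0 by (simp add: r_def sum_subtractf sum_lap sum_distrib_left[symmetric])
  have "(\<Sum>v\<in>?V. r v * r v) = 0"
  proof (rule nonneg_parabola_imp_zero)
    fix t
    have "sum (\<lambda>v. f v + t * r v) ?V = 0" using f0 r0 by (simp add: sum.distrib sum_distrib_left[symmetric])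
    then have "0 \<le> energy G (\<lambda>v. f v + t * r v) (\<lambda>v. f v + t * r v) - \<mu> * nrm (\<lambda>v. f v + t * r v)"
      using min by simp
    also have "energy G (\<lambda>v. f v + t * r v) (\<lambda>v. f v + t * r v)
        = \<mu> + 2 * t * energy G f r + t\<^sup>2 * energy G r r"
      unfolding \<mu>_def energy_eq
      by (simp add: sum_distrib_left sum_divide_distrib sum.distrib[symmetric])
         (intro sum.cong refl, simp add: field_simps power2_eq_square)
    also have "nrm (\<lambda>v. f v + t * r v) = nrm f + 2 * t * (\<Sum>v\<in>?V. f v * r v) + t\<^sup>2 * nrm r"
      unfolding nrm_def
      by (simp add: sum_distrib_left sum.distrib[symmetric])
         (intro sum.cong refl, simp add: algebra_simps power2_eq_square)
    also have "\<mu> + 2 * t * energy G f r + t\<^sup>2 * energy G r r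
        - \<mu> * (nrm f + 2 * t * (\<Sum>v\<in>?V. f v * r v) + t\<^sup>2 * nrm r)
        = 2 * t * (energy G f r - \<mu> * (\<Sum>v\<in>?V. f v * r v)) + t\<^sup>2 * (energy G r r - \<mu> * nrm r)"
      by (simp add: f1 algebra_simps)
    also have "energy G f r - \<mu> * (\<Sum>v\<in>?V. f v * r v) = (\<Sum>v\<in>?V. r v * r v)"
      by (simp add: energy_def sum_distrib_left sum_subtractf[symmetric] r_def algebra_simps)
    finally show "0 \<le> 2 * t * (\<Sum>v\<in>?V. r v * r v) + t\<^sup>2 * (energy G r r - \<mu> * nrm r)" .
  qed
  then have "r v = 0" if "v \<in> ?V" for v using that fin by (simp add: sum_nonneg_eq_0_iff)
  then have "lap G f v = \<mu> * f v" if "v \<in> ?V" for v using that by (simp add: r_def)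
  then show thesis using that f0 f1 min unfolding nrm_def by blast
qed

lemma connected_imp_constant:
  assumes "Digraph_Component.connected (with_proj G)"
    and "\<And>u v. (u, v) \<in> parcs G \<Longrightarrow> f u = f v"
    and "u \<in> pverts G" "v \<in> pverts G"
  shows "f u = f v"
proof -
  have "u \<rightarrow>\<^sup>*\<^bsub>with_proj (mk_symmetric (with_proj G))\<^esub> v"
    using assms unfolding Digraph_Component.connected_def strongly_connected_def by simp
  then have "(u, v) \<in> rtrancl_on (pverts G) (parcs (mk_symmetric (with_proj G)))"
    by (simp add: reachable_def)
  then show ?thesis
  proof induction
    case (step y z)
    then have "(y, z) \<in> parcs G \<or> (z, y) \<in> parcs G" by (auto simp: parcs_mk_symmetric)
    then show ?case using step assms(2) by metis
  qed simp
qed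

text \<open>
  The variational bound for the second eigenvalue. The minimum \<open>\<mu>\<close> of the Rayleigh quotient is an
  eigenvalue, and it is positive because on a connected graph only constants have energy zero.
  Since \<open>0\<close> is an eigenvalue too, the characteristic polynomial has two distinct roots that are at
  most \<open>\<mu>\<close>, so its second smallest root is at most \<open>\<mu>\<close>, whatever the multiplicities.
\<close>

theorem spectral_gap_le_rayleigh:
  assumes conn: "Digraph_Component.connected (with_proj G)" and h: "sum h (pverts G) = 0"
  shows "spectral_gap G * (\<Sum>v\<in>pverts G. (h v)\<^sup>2) \<le> energy G h h"
proof (cases "\<exists>v\<in>pverts G. h v \<noteq> 0")
  case False
  then show ?thesis by (simp add: energy_def)
next
  case True
  let ?V = "pverts G"
  have fin: "finite ?V" using pair_finite_verts by simp
  obtain f \<mu> where f0: "sum f ?V = 0" and f1: "(\<Sum>v\<in>?V. (f v)\<^sup>2) = 1"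
    and eig: "\<And>v. v \<in> ?V \<Longrightarrow> lap G f v = \<mu> * f v"
    and min: "\<And>h. sum h ?V = 0 \<Longrightarrow> \<mu> * (\<Sum>v\<in>?V. (h v)\<^sup>2) \<le> energy G h h"
    using True h rayleigh_minimiser by metis
  obtain w where w: "w \<in> ?V" "f w \<noteq> 0"
    using f1 by (metis sum.neutral zero_neq_one zero_power2)
  have \<mu>: "\<mu> = energy G f f"
    using f1 by (simp add: energy_def eig mult.assoc sum_distrib_left[symmetric] power2_eq_square)
  have terms: "adj G v u * (f v - f u) * (f v - f u) \<ge> 0" for u v
    by (simp add: adj_def)
  have "\<mu> \<noteq> 0"
  proof
    assume "\<mu> = 0"
    then have "(\<Sum>v\<in>?V. \<Sum>u\<in>?V. adj G v u * (f v - f u) * (f v - f u)) = 0"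
      using \<mu> by (simp add: energy_eq)
    then have *: "adj G v u * (f v - f u) * (f v - f u) = 0" if "v \<in> ?V" "u \<in> ?V" for u v
      using that fin terms by (simp add: sum_nonneg_eq_0_iff sum_nonneg)
    have "f u = f v" if "(u, v) \<in> parcs G" for u v
      using that *[of u v] by (auto simp: adj_def dest: in_arcsD1 in_arcsD2)
    then have "f v = f w" if "v \<in> ?V" for v using connected_imp_constant[OF conn, of f] that w by blast
    then have "sum f ?V = real (card ?V) * f w" by simp
    then show False using f0 w fin by auto
  qed
  moreover have "\<mu> \<ge> 0" using terms by (simp add: \<mu> energy_eq sum_nonneg)
  ultimately have pos: "\<mu> > 0" by simp
  define xs where "xs = sorted_list_of_multiset (proots (char_poly (laplacian G)))"
  have "\<mu> \<in> set xs" using eigenfunction_imp_root[OF eig w] by (simp add: xs_def)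
  then obtain j where j: "j < length xs" "xs ! j = \<mu>" by (metis in_set_conv_nth)
  have "0 \<in> set xs" using eigenfunction_imp_root[of "\<lambda>_. 1" 0 w] w by (simp add: xs_def lap_def)
  then obtain i where i: "i < length xs" "xs ! i = 0" by (metis in_set_conv_nth)
  have sorted: "sorted xs" by (simp add: xs_def)
  have "j \<noteq> 0"
    using sorted_nth_mono[OF sorted, of 0 i] i j pos by (cases "j = 0") auto
  then have "xs ! 1 \<le> \<mu>" using sorted_nth_mono[OF sorted, of 1 j] j by simp
  then have "spectral_gap G \<le> \<mu>"
    by (simp add: spectral_gap_def laplacian_eigenvalue_def xs_def)
  then have "spectral_gap G * (\<Sum>v\<in>?V. (h v)\<^sup>2) \<le> \<mu> * (\<Sum>v\<in>?V. (h v)\<^sup>2)"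
    by (intro mult_right_mono sum_nonneg) auto
  also have "\<dots> \<le> energy G h h" by (rule min[OF h])
  finally show ?thesis .
qed

end

section \<open>Cochains of clique complexes and the spectral gap\<close>

lemma pverts_skeleton:
  assumes "simplicial_complex X" shows "pverts (skeleton X) = \<Union>X"
  using simplicial_complexD(1)[OF assms]
  by (auto simp: skeleton_def simplices_def)

lemma parcs_skeleton: "(u, v) \<in> parcs (skeleton X) \<longleftrightarrow> u \<noteq> v \<and> {u, v} \<in> X"
  by (cases "u = v") (auto simp: skeleton_def simplices_def)

lemma pair_graph_skeleton:
  assumes "simplicial_complex X" shows "pair_graph (skeleton X)"
proof
  let ?G = "skeleton X"
  have sub: "parcs ?G \<subseteq> pverts ?G \<times> pverts ?G"
    using pverts_skeleton[OF assms] by (auto simp: parcs_skeleton)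
  show fin: "finite (pverts ?G)" unfolding pverts_skeleton[OF assms] by (rule simplicial_complexD(2)[OF assms])
  show "finite (parcs ?G)" using finite_subset[OF sub] fin by simp
  show "symmetric (with_proj ?G)"
    by (auto simp: symmetric_def parcs_skeleton insert_commute intro!: symI)
  fix e assume e: "e \<in> parcs ?G"
  show "fst e \<in> pverts ?G" and "snd e \<in> pverts ?G" using e sub by auto
  show "fst e \<noteq> snd e" using e parcs_skeleton[of "fst e" "snd e" X] by simp
qed

lemma clique_complex_simplexI:
  assumes "clique_complex X" "clique (skeleton X) C" "card C = Suc m"
  shows "C \<in> X"
  using assms unfolding clique_complex_def simplices_def by auto

text \<open>
  Count, for each vertex \<open>u\<close>, its neighbours in \<open>\<sigma>\<close>. If \<open>u\<close> misses some vertex of \<open>\<sigma>\<close> (itself,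
  if it lies in \<open>\<sigma>\<close>), there are at most \<open>k\<close>. Otherwise there are \<open>k + 1\<close>, but then \<open>u\<close> and \<open>\<sigma>\<close>
  form a clique and hence a simplex, which accounts for the extra one.
\<close>

lemma sum_degree_le:
  assumes X: "simplicial_complex X" "clique_complex X" and \<sigma>: "\<sigma> \<in> X" "card \<sigma> = Suc k"
  shows "(\<Sum>v\<in>\<sigma>. \<Sum>u\<in>\<Union>X. adj (skeleton X) v u)
       \<le> real k * real (card (\<Union>X)) + (\<Sum>u\<in>\<Union>X. of_bool (u \<notin> \<sigma> \<and> insert u \<sigma> \<in> X))"
proof -
  let ?a = "adj (skeleton X)"
  have fin: "finite \<sigma>" using \<sigma>(2) card.infinite by fastforce
  have "(\<Sum>v\<in>\<sigma>. ?a v u) \<le> real k + of_bool (u \<notin> \<sigma> \<and> insert u \<sigma> \<in> X)" if u: "u \<in> \<Union>X" for u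
  proof (cases "\<forall>v\<in>\<sigma>. (v, u) \<in> parcs (skeleton X)")
    case True
    then have "u \<notin> \<sigma>" by (auto simp: parcs_skeleton)
    moreover have "clique (skeleton X) (insert u \<sigma>)"
      using True u fin \<sigma>(1) simplicial_complexD(1)[OF X(1) \<sigma>(1)] pverts_skeleton[OF X(1)]
      by (auto simp: clique_def parcs_skeleton insert_commute)
    then have "insert u \<sigma> \<in> X"
      using clique_complex_simplexI[OF X(2), of "insert u \<sigma>" "Suc k"] \<sigma>(2) fin \<open>u \<notin> \<sigma>\<close> by simp
    ultimately show ?thesis using True \<sigma>(2) by (simp add: adj_def)
  next
    case False
    then obtain v where v: "v \<in> \<sigma>" "?a v u = 0" by (auto simp: adj_def)
    have "(\<Sum>v\<in>\<sigma>. ?a v u) = (\<Sum>v\<in>\<sigma> - {v}. ?a v u)" using v fin by (simp add: sum.remove)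
    also have "\<dots> \<le> real (card (\<sigma> - {v}))"
      using sum_bounded_above[of "\<sigma> - {v}" "\<lambda>v. ?a v u" 1] by (simp add: adj_def)
    also have "\<dots> = real k" using v \<sigma>(2) fin by simp
    finally show ?thesis by simp
  qed
  then have "(\<Sum>u\<in>\<Union>X. \<Sum>v\<in>\<sigma>. ?a v u)
      \<le> (\<Sum>u\<in>\<Union>X. real k + of_bool (u \<notin> \<sigma> \<and> insert u \<sigma> \<in> X))"
    by (rule sum_mono)
  then show ?thesis by (subst sum.swap) (simp add: sum.distrib mult.commute)
qed

text \<open>
  The squared norm of a coboundary consists of diagonal terms, one for each coface of a
  simplex, and of products over two faces of the same simplex. By symmetry every ordered pair of
  faces may be brought to the form in which the omitted vertices are the first two.
\<close>

lemma sum_face_sum_squares: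
  fixes k :: nat
  assumes X: "simplicial_complex X" and alt: "alternating h"
  defines "M vs \<equiv> of_bool (vs \<in> ordered_simplices X (int k + 1)) :: real"
  shows "(\<Sum>vs\<in>box (\<Union>X) (Suc (Suc k)). M vs * (face_sum h vs)\<^sup>2)
       = real (k + 2) * ((\<Sum>u\<in>\<Union>X. \<Sum>vs\<in>box (\<Union>X) (Suc k). M (u # vs) * (h vs)\<^sup>2)
         - real (k + 1) * (\<Sum>u\<in>\<Union>X. \<Sum>v\<in>\<Union>X. \<Sum>vs\<in>box (\<Union>X) k. M (u # v # vs) * (h (u # vs) * h (v # vs))))"
proof -
  let ?V = "\<Union>X"
  note fin = simplicial_complexD(2)[OF X]
  have M: "M (to_front i vs) = M vs" if "i < length vs" for i vs
    using that by (simp add: M_def ordered_simplices_iff)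
  have M': "M (u # to_front i vs) = M (u # vs)" if "i < length vs" for i u vs
    using that by (simp add: M_def ordered_simplices_iff)
  have "(\<Sum>vs\<in>box ?V (Suc (Suc k)). M vs * (face_sum h vs)\<^sup>2)
      = (\<Sum>vs\<in>box ?V (Suc (Suc k)). M vs * (face_sum h vs * face_sum h vs))"
    by (simp add: power2_eq_square)
  also have "\<dots> = real (k + 2) * (\<Sum>vs\<in>box ?V (Suc (Suc k)). M vs * (face_sum h vs * h (tl vs)))"
    using sum_box_face_sum[OF fin alternating_face_sum[OF alt] M, where m = "Suc (Suc k)" and \<phi> = h] by simp
  also have "(\<Sum>vs\<in>box ?V (Suc (Suc k)). M vs * (face_sum h vs * h (tl vs)))
      = (\<Sum>u\<in>?V. \<Sum>vs\<in>box ?V (Suc k). M (u # vs) * (h vs)\<^sup>2)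
      - (\<Sum>u\<in>?V. \<Sum>vs\<in>box ?V (Suc k). M (u # vs) * (h vs * face_sum (\<lambda>ys. h (u # ys)) vs))"
    by (simp add: sum_box_Suc[of _ _ "Suc k"] sum_subtractf[symmetric] algebra_simps power2_eq_square)
  also have "(\<Sum>u\<in>?V. \<Sum>vs\<in>box ?V (Suc k). M (u # vs) * (h vs * face_sum (\<lambda>ys. h (u # ys)) vs))
      = (\<Sum>u\<in>?V. real (k + 1) * (\<Sum>vs\<in>box ?V (Suc k). M (u # vs) * (h vs * h (u # tl vs))))"
  proof (rule sum.cong[OF refl])
    fix u
    show "(\<Sum>vs\<in>box ?V (Suc k). M (u # vs) * (h vs * face_sum (\<lambda>ys. h (u # ys)) vs))
        = real (k + 1) * (\<Sum>vs\<in>box ?V (Suc k). M (u # vs) * (h vs * h (u # tl vs)))"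
      using sum_box_face_sum[OF fin alt, where w = "\<lambda>vs. M (u # vs)" and m = "Suc k" and \<phi> = "\<lambda>ys. h (u # ys)"] M'
      by simp
  qed
  also have "\<dots> = real (k + 1) * (\<Sum>u\<in>?V. \<Sum>v\<in>?V. \<Sum>vs\<in>box ?V k. M (u # v # vs) * (h (u # vs) * h (v # vs)))"
    by (simp add: sum_box_Suc sum_distrib_left mult_ac)
  finally show ?thesis .
qed

text \<open>
  Fixing all but one vertex of \<open>h\<close> gives a function on the vertices, which has sum zero as \<open>h\<close> is
  coclosed, so the spectral gap bounds its norm by its energy. Summed over the fixed vertices, the
  norms give the norm of \<open>h\<close>, and the energies give a degree term minus products of two values of
  \<open>h\<close> at \<open>u # vs\<close> and \<open>v # vs\<close> for adjacent \<open>u\<close> and \<open>v\<close>. If neither value vanishes then, by the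
  clique condition, adjacency of \<open>u\<close> and \<open>v\<close> means that \<open>u # v # vs\<close> spans a simplex, so that
  these are exactly the mixed terms in the squared norm of the coboundary. The degree
  terms combine with the diagonal terms of that norm, and the count of neighbours of a simplex bounds
  the difference.
\<close>

theorem spectral_gap_cochain_estimate:
  assumes X: "simplicial_complex X" "connected_complex X" "clique_complex X"
    and alt: "alternating h" and supp: "\<And>vs. h vs \<noteq> 0 \<Longrightarrow> vs \<in> ordered_simplices X (int k)"
    and coclosed: "\<And>vs. (\<Sum>v\<in>\<Union>X. h (v # vs)) = 0"
  shows "real (k + 1) * spectral_gap (skeleton X) * (\<Sum>vs\<in>box (\<Union>X) (k + 1). (h vs)\<^sup>2)
       \<le> real k * real (card (\<Union>X)) * (\<Sum>vs\<in>box (\<Union>X) (k + 1). (h vs)\<^sup>2)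
         + (\<Sum>vs\<in>box (\<Union>X) (k + 2). of_bool (vs \<in> ordered_simplices X (int k + 1)) * (face_sum h vs)\<^sup>2)
           / real (k + 2)"
proof -
  let ?V = "\<Union>X" and ?G = "skeleton X" and ?a = "adj (skeleton X)"
  interpret G: pair_graph ?G by (rule pair_graph_skeleton[OF X(1)])
  note fin = simplicial_complexD(2)[OF X(1)] and V = pverts_skeleton[OF X(1)]
  define \<gamma> where "\<gamma> = spectral_gap ?G"
  define N where "N = (\<Sum>vs\<in>box ?V (Suc k). (h vs)\<^sup>2)"
  define M where "M vs = (of_bool (vs \<in> ordered_simplices X (int k + 1)) :: real)" for vs
  define A where "A = (\<Sum>u\<in>?V. \<Sum>vs\<in>box ?V (Suc k). M (u # vs) * (h vs)\<^sup>2)"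
  define C where "C = (\<Sum>u\<in>?V. \<Sum>v\<in>?V. \<Sum>vs\<in>box ?V k. M (u # v # vs) * (h (u # vs) * h (v # vs)))"
  define deg where "deg v = (\<Sum>u\<in>?V. ?a v u)" for v
  define T where "T = (\<Sum>vs\<in>box ?V (Suc k). deg (hd vs) * (h vs)\<^sup>2)"
  have gap: "\<gamma> * (\<Sum>v\<in>?V. (f v)\<^sup>2)
      \<le> (\<Sum>v\<in>?V. deg v * (f v)\<^sup>2) - (\<Sum>u\<in>?V. \<Sum>v\<in>?V. ?a u v * (f u * f v))"
    if "sum f ?V = 0" for f
  proof -
    have "\<gamma> * (\<Sum>v\<in>?V. (f v)\<^sup>2) \<le> energy ?G f f"
      using G.spectral_gap_le_rayleigh[of f] X(2) that V by (simp add: connected_complex_def \<gamma>_def)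
    also have "energy ?G f f = (\<Sum>v\<in>?V. deg v * (f v)\<^sup>2) - (\<Sum>u\<in>?V. \<Sum>v\<in>?V. ?a u v * (f u * f v))"
      by (simp add: energy_def lap_def V deg_def sum_distrib_right sum_distrib_left sum_subtractf
          algebra_simps power2_eq_square)
    finally show ?thesis .
  qed
  \<comment> \<open>Where both values of \<open>h\<close> are nonzero, \<open>u\<close> and \<open>v\<close> are each joined to all of \<open>vs\<close>, so that
  an edge between them completes a clique.\<close>
  have adj_iff: "?a u v * (h (u # vs) * h (v # vs)) = M (u # v # vs) * (h (u # vs) * h (v # vs))" for u v vs
  proof (cases "h (u # vs) = 0 \<or> h (v # vs) = 0")
    case False
    then have u: "u # vs \<in> ordered_simplices X (int k)" and v: "v # vs \<in> ordered_simplices X (int k)"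
      using supp by auto
    have "(u, v) \<in> parcs ?G \<longleftrightarrow> u # v # vs \<in> ordered_simplices X (int k + 1)"
    proof
      assume "u # v # vs \<in> ordered_simplices X (int k + 1)"
      then show "(u, v) \<in> parcs ?G"
        using simplicial_complexD(1)[OF X(1), of "set (u # v # vs)" "{u, v}"]
        by (auto simp: ordered_simplices_iff parcs_skeleton)
    next
      assume uv: "(u, v) \<in> parcs ?G"
      let ?C = "insert u (insert v (set vs))"
      have edge: "(a, b) \<in> parcs ?G" if "a \<noteq> b" "{a, b} \<subseteq> insert u (set vs) \<or> {a, b} \<subseteq> insert v (set vs)" for a b
        using that u v simplicial_complexD(1)[OF X(1)] by (auto simp: parcs_skeleton ordered_simplices_iff)
      have "(a, b) \<in> parcs ?G" if "a \<in> ?C" "b \<in> ?C" "a \<noteq> b" for a b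
        using that edge[of a b] uv by (auto simp: parcs_skeleton insert_commute)
      moreover have "?C \<subseteq> pverts ?G" using u v V by (auto simp: ordered_simplices_iff)
      ultimately have "clique ?G ?C" by (simp add: clique_def)
      moreover have dist: "distinct (u # v # vs)" using u v uv by (auto simp: ordered_simplices_iff parcs_skeleton)
      then have "card ?C = Suc (Suc (length vs))" by (simp add: distinct_card)
      ultimately have "?C \<in> X" by (rule clique_complex_simplexI[OF X(3)])
      then show "u # v # vs \<in> ordered_simplices X (int k + 1)"
        using dist u by (simp add: ordered_simplices_iff)
    qed
    then show ?thesis by (simp add: adj_def M_def)
  qed auto
  have "\<gamma> * N = (\<Sum>vs\<in>box ?V k. \<gamma> * (\<Sum>v\<in>?V. (h (v # vs))\<^sup>2))"
    by (simp add: N_def sum_box_Suc sum_distrib_left) (rule sum.swap)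
  also have "\<dots> \<le> (\<Sum>vs\<in>box ?V k. (\<Sum>v\<in>?V. deg v * (h (v # vs))\<^sup>2)
      - (\<Sum>u\<in>?V. \<Sum>v\<in>?V. M (u # v # vs) * (h (u # vs) * h (v # vs))))"
    using gap[OF coclosed] by (intro sum_mono) (simp add: adj_iff)
  also have "\<dots> = T - C"
  proof -
    have "(\<Sum>vs\<in>box ?V k. \<Sum>v\<in>?V. deg v * (h (v # vs))\<^sup>2) = T"
      by (simp add: T_def sum_box_Suc) (rule sum.swap)
    moreover have "(\<Sum>vs\<in>box ?V k. \<Sum>u\<in>?V. \<Sum>v\<in>?V. M (u # v # vs) * (h (u # vs) * h (v # vs))) = C"
      unfolding C_def by (subst sum.swap) (intro sum.cong refl, rule sum.swap)
    ultimately show ?thesis by (simp add: sum_subtractf)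
  qed
  finally have 1: "\<gamma> * N \<le> T - C" .
  have "real (k + 1) * T = (\<Sum>vs\<in>box ?V (Suc k). \<Sum>i<Suc k. deg (hd (to_front i vs)) * (h (to_front i vs))\<^sup>2)"
    unfolding T_def using sum_box_fronts[OF fin, where m = "Suc k" and g = "\<lambda>vs. deg (hd vs) * (h vs)\<^sup>2"] by simp
  also have "\<dots> \<le> (\<Sum>vs\<in>box ?V (Suc k). (real k * real (card ?V) + (\<Sum>u\<in>?V. M (u # vs))) * (h vs)\<^sup>2)"
  proof (rule sum_mono)
    fix vs assume "vs \<in> box ?V (Suc k)"
    then have len: "length vs = Suc k" by (simp add: box_def)
    show "(\<Sum>i<Suc k. deg (hd (to_front i vs)) * (h (to_front i vs))\<^sup>2)
        \<le> (real k * real (card ?V) + (\<Sum>u\<in>?V. M (u # vs))) * (h vs)\<^sup>2"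
    proof (cases "h vs = 0")
      case True
      then show ?thesis using len by (simp add: alternating_to_front[OF alt] del: sum.lessThan_Suc)
    next
      case False
      then have vs: "distinct vs" "set vs \<in> X" using supp by (auto simp: ordered_simplices_iff)
      have "(\<Sum>i<Suc k. deg (hd (to_front i vs)) * (h (to_front i vs))\<^sup>2)
          = (\<Sum>i<Suc k. deg (vs ! i)) * (h vs)\<^sup>2"
        using len by (simp add: alternating_to_front[OF alt] power_mult_distrib sum_distrib_right
            power_mult[symmetric] mult.commute[of _ 2] power_mult del: sum.lessThan_Suc)
      also have "(\<Sum>i<Suc k. deg (vs ! i)) = (\<Sum>v\<in>set vs. deg v)"
        using sum.reindex_bij_betw[OF bij_betw_nth[OF vs(1) refl refl], of deg] len by simp
      also have "\<dots> \<le> real k * real (card ?V) + (\<Sum>u\<in>?V. of_bool (u \<notin> set vs \<and> insert u (set vs) \<in> X))"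
        unfolding deg_def using sum_degree_le[OF X(1,3) vs(2)] vs(1) len by (simp add: distinct_card)
      also have "(\<Sum>u\<in>?V. of_bool (u \<notin> set vs \<and> insert u (set vs) \<in> X)) = (\<Sum>u\<in>?V. M (u # vs))"
        using vs len by (intro sum.cong refl) (auto simp: M_def ordered_simplices_iff)
      finally show ?thesis by (simp add: mult_right_mono)
    qed
  qed
  also have "\<dots> = real k * real (card ?V) * N + A"
  proof -
    have "A = (\<Sum>vs\<in>box ?V (Suc k). (\<Sum>u\<in>?V. M (u # vs)) * (h vs)\<^sup>2)"
      unfolding A_def by (subst sum.swap) (simp add: sum_distrib_right)
    then show ?thesis by (simp add: N_def distrib_right sum.distrib sum_distrib_left)
  qed
  finally have 2: "real (k + 1) * T \<le> real k * real (card ?V) * N + A" .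
  have 3: "(\<Sum>vs\<in>box ?V (Suc (Suc k)). M vs * (face_sum h vs)\<^sup>2) / real (k + 2) = A - real (k + 1) * C"
    using sum_face_sum_squares[OF X(1) alt, of k] unfolding M_def A_def C_def by simp
  have "real (k + 1) * (\<gamma> * N) \<le> real (k + 1) * (T - C)" using 1 by (intro mult_left_mono) auto
  also have "\<dots> \<le> real k * real (card ?V) * N + (A - real (k + 1) * C)"
    using 2 by (simp add: right_diff_distrib)
  finally show ?thesis unfolding 3[symmetric] by (simp add: N_def M_def \<gamma>_def mult.assoc)
qed

section \<open>Vanishing of the cohomology of a subcomplex\<close>

lemma missing_cofaces_le:
  assumes X: "simplicial_complex X" "subcomplex X' X" and vs: "vs \<in> ordered_simplices X' (int k)"
  shows "card {u \<in> \<Union>X. u # vs \<in> ordered_simplices X (int k + 1) - ordered_simplices X' (int k + 1)}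
       \<le> max_missing_cofaces (int k) X X'"
proof -
  let ?F = "\<lambda>\<sigma>. {\<tau> \<in> simplices X (int k + 1) - simplices X' (int k + 1). \<sigma> \<subset> \<tau>}"
  let ?U = "{u \<in> \<Union>X. u # vs \<in> ordered_simplices X (int k + 1) - ordered_simplices X' (int k + 1)}"
  have "finite X" "finite X'" using X by (auto simp: subcomplex_def simplicial_complex_def)
  then have fin: "finite (simplices X' (int k))" "finite (?F \<sigma>)" for \<sigma> by (auto simp: simplices_def)
  have mem: "set vs \<in> simplices X' (int k)" using vs by (simp add: ordered_simplices_def)
  have "inj_on (\<lambda>u. insert u (set vs)) ?U"
    by (auto simp: inj_on_def ordered_simplices_iff)
  moreover have "(\<lambda>u. insert u (set vs)) ` ?U \<subseteq> ?F (set vs)"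
    by (auto simp: ordered_simplices_def)
  ultimately have "card ?U \<le> card (?F (set vs))" using fin(2) by (rule card_inj_on_le)
  also have "\<dots> \<le> Max ((\<lambda>\<sigma>. card (?F \<sigma>)) ` simplices X' (int k))"
    using fin mem by (intro Max_ge) auto
  finally show ?thesis using mem by (auto simp: max_missing_cofaces_def)
qed

lemma face_sum_square_le: "(face_sum \<phi> vs)\<^sup>2 \<le> real (length vs) * (\<Sum>i<length vs. (\<phi> (omit i vs))\<^sup>2)"
  using sum_squared_le_sum_of_squares[of "\<lambda>i. (- 1) ^ i * \<phi> (omit i vs)" "{..<length vs}"]
  by (simp add: face_sum_eq power_mult_distrib mult.commute power_mult[symmetric])

text \<open>
  A cocycle of the subcomplex, extended by zero, has a coboundary in the whole complex that is
  supported on the missing simplices. The Cauchy-Schwarz inequality over their \<open>k + 2\<close> faces gives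
  one factor \<open>k + 2\<close>; the choice of the face to be moved to the front gives the other.
\<close>

lemma cocycle_coboundary_estimate:
  assumes X: "simplicial_complex X" "subcomplex X' X"
    and h: "h \<in> cochains X' (int k)"
    and cocycle: "\<And>vs. vs \<in> ordered_simplices X' (int k + 1) \<Longrightarrow> face_sum h vs = 0"
  shows "(\<Sum>vs\<in>box (\<Union>X) (k + 2). of_bool (vs \<in> ordered_simplices X (int k + 1)) * (face_sum h vs)\<^sup>2)
       \<le> (real (k + 2))\<^sup>2 * real (max_missing_cofaces (int k) X X') * (\<Sum>vs\<in>box (\<Union>X) (k + 1). (h vs)\<^sup>2)"
proof -
  let ?V = "\<Union>X" and ?S = "real (max_missing_cofaces (int k) X X')"
  note fin = simplicial_complexD(2)[OF X(1)]
  define D where "D vs = (of_bool (vs \<in> ordered_simplices X (int k + 1) - ordered_simplices X' (int k + 1)) :: real)" for vs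
  have D_front: "D (to_front i vs) = D vs" if "i < length vs" for i vs
    using that by (simp add: D_def ordered_simplices_iff)
  have "(\<Sum>vs\<in>box ?V (k + 2). of_bool (vs \<in> ordered_simplices X (int k + 1)) * (face_sum h vs)\<^sup>2)
      = (\<Sum>vs\<in>box ?V (k + 2). D vs * (face_sum h vs)\<^sup>2)"
    using cocycle by (intro sum.cong refl) (auto simp: D_def)
  also have "\<dots> \<le> (\<Sum>vs\<in>box ?V (k + 2). D vs * (real (k + 2) * (\<Sum>i<k + 2. (h (omit i vs))\<^sup>2)))"
  proof (intro sum_mono mult_left_mono)
    fix vs assume "vs \<in> box ?V (k + 2)"
    then show "(face_sum h vs)\<^sup>2 \<le> real (k + 2) * (\<Sum>i<k + 2. (h (omit i vs))\<^sup>2)"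
      using face_sum_square_le[of h vs] by (simp add: box_def del: sum.lessThan_Suc)
  qed (simp add: D_def)
  also have "\<dots> = real (k + 2) * (\<Sum>vs\<in>box ?V (k + 2). \<Sum>i<k + 2. D (to_front i vs) * (h (tl (to_front i vs)))\<^sup>2)"
    unfolding sum_distrib_left
    by (intro sum.cong refl) (auto simp: box_def D_front sum_distrib_left mult_ac)
  also have "\<dots> = real (k + 2) * (real (k + 2) * (\<Sum>vs\<in>box ?V (k + 2). D vs * (h (tl vs))\<^sup>2))"
    using sum_box_fronts[OF fin, where m = "k + 2" and g = "\<lambda>vs. D vs * (h (tl vs))\<^sup>2"] by simp
  also have "(\<Sum>vs\<in>box ?V (k + 2). D vs * (h (tl vs))\<^sup>2) = (\<Sum>vs\<in>box ?V (k + 1). (\<Sum>u\<in>?V. D (u # vs)) * (h vs)\<^sup>2)"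
    by (simp add: sum_box_Suc[of _ _ "Suc k"] sum_distrib_right) (rule sum.swap)
  also have "real (k + 2) * (real (k + 2) * (\<Sum>vs\<in>box ?V (k + 1). (\<Sum>u\<in>?V. D (u # vs)) * (h vs)\<^sup>2))
      \<le> real (k + 2) * (real (k + 2) * (\<Sum>vs\<in>box ?V (k + 1). ?S * (h vs)\<^sup>2))"
  proof (intro mult_left_mono sum_mono)
    fix vs
    show "(\<Sum>u\<in>?V. D (u # vs)) * (h vs)\<^sup>2 \<le> ?S * (h vs)\<^sup>2"
    proof (cases "h vs = 0")
      case False
      then have "vs \<in> ordered_simplices X' (int k)" using h by (auto simp: cochains_iff)
      moreover have "(\<Sum>u\<in>?V. D (u # vs)) = real (card {u \<in> ?V. u # vs \<in> ordered_simplices X (int k + 1) - ordered_simplices X' (int k + 1)})"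
        using fin by (simp add: D_def of_bool_def sum.If_cases Int_def)
      ultimately show ?thesis using missing_cofaces_le[OF X] by (simp add: mult_right_mono)
    qed simp
  qed auto
  also have "\<dots> = (real (k + 2))\<^sup>2 * ?S * (\<Sum>vs\<in>box ?V (k + 1). (h vs)\<^sup>2)"
    by (simp add: sum_distrib_left power2_eq_square mult.assoc)
  finally show ?thesis .
qed

theorem corollary1p5:
  fixes X X' :: "'a set set" and k n :: nat
  assumes "k \<ge> 1"
    and "simplicial_complex X"
    and "card (simplices X 0) = n"
    and "connected_complex X"
    and "clique_complex X"
    and "subcomplex X' X"
    and "skeleton X' = skeleton X"
    and "spectral_gap (skeleton X) >
           real k * real n / (real k + 1) + (real k + 2) / (real k + 1) * real (max_missing_cofaces (int k) X X')"
  shows "trivial_group (reduced_cohomology X' (int k))"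
proof (rule trivial_reduced_cohomologyI, rule subsetI)
  fix \<phi> assume \<phi>: "\<phi> \<in> cocycles X' (int k)"
  note X = assms(2) and sub = assms(6)
  have X': "simplicial_complex X'" using sub by (simp add: subcomplex_def)
  have V: "\<Union>X' = \<Union>X" using assms(7) pverts_skeleton[OF X] pverts_skeleton[OF X'] by simp
  have n: "card (\<Union>X) = n"
  proof -
    have "simplices X 0 = (\<lambda>v. {v}) ` \<Union>X"
      using simplicial_complexD(1)[OF X] by (auto simp: simplices_def card_1_singleton_iff)
    then show ?thesis using assms(3) by (simp add: card_image)
  qed
  obtain h where h: "h \<in> cochains X' (int k)"
    and diff: "(\<lambda>vs. \<phi> vs - h vs) \<in> coboundaries X' (int k)"
    and cocycle: "\<And>vs. vs \<in> ordered_simplices X' (int k + 1) \<Longrightarrow> face_sum h vs = 0"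
    and coclosed: "\<And>vs. (\<Sum>v\<in>\<Union>X'. h (v # vs)) = 0"
    using cocycle_coclosed_representative[OF X' \<phi>] by metis
  have alt: "alternating h" and supp': "\<And>vs. h vs \<noteq> 0 \<Longrightarrow> vs \<in> ordered_simplices X' (int k)"
    using h by (auto simp: cochains_iff)
  have supp: "vs \<in> ordered_simplices X (int k)" if "h vs \<noteq> 0" for vs
    using supp'[OF that] sub by (auto simp: ordered_simplices_iff subcomplex_def)
  define N where "N = (\<Sum>vs\<in>box (\<Union>X) (k + 1). (h vs)\<^sup>2)"
  define S where "S = real (max_missing_cofaces (int k) X X')"
  define B where "B = (\<Sum>vs\<in>box (\<Union>X) (k + 2). of_bool (vs \<in> ordered_simplices X (int k + 1)) * (face_sum h vs)\<^sup>2)"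
  have est: "real (k + 1) * spectral_gap (skeleton X) * N \<le> real k * real n * N + B / real (k + 2)"
    unfolding n[symmetric] N_def B_def
    by (rule spectral_gap_cochain_estimate[OF X assms(4,5) alt])
       (use supp coclosed[unfolded V] in \<open>simp_all\<close>)
  have "B \<le> (real (k + 2))\<^sup>2 * S * N"
    unfolding B_def N_def S_def by (rule cocycle_coboundary_estimate[OF X sub h cocycle])
  then have "B / real (k + 2) \<le> real (k + 2) * S * N"
    by (simp add: divide_le_eq power2_eq_square mult_ac)
  with est have "(real (k + 1) * spectral_gap (skeleton X) - (real k * real n + real (k + 2) * S)) * N \<le> 0"
    by (simp add: left_diff_distrib distrib_right)
  moreover have "real (k + 1) * spectral_gap (skeleton X) - (real k * real n + real (k + 2) * S) > 0"
  proof -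
    have "(real k * real n + (real k + 2) * S) / (real k + 1) < spectral_gap (skeleton X)"
      using assms(8) by (simp add: S_def add_divide_distrib distrib_right)
    then show ?thesis by (simp add: pos_divide_less_eq algebra_simps)
  qed
  ultimately have "N \<le> 0" by (simp add: mult_le_0_iff)
  then have zero: "h vs = 0" if "vs \<in> box (\<Union>X) (k + 1)" for vs
    using that finite_box[OF simplicial_complexD(2)[OF X]]
    by (auto simp: N_def sum_nonneg_eq_0_iff sum_nonneg dest!: antisym)
  have "h vs = 0" for vs
  proof (rule ccontr)
    assume nz: "h vs \<noteq> 0"
    then have "vs \<in> box (\<Union>X) (k + 1)" using supp[OF nz] by (auto simp: ordered_simplices_iff box_def)
    then show False using zero nz by simp
  qed
  then show "\<phi> \<in> coboundaries X' (int k)" using diff by simp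
qed

end
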